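(* Let $\alpha=(\alpha_1,\ldots,\alpha_n)$ be an $n$-tuple of integers, and let $R=\mathbb{C}[x_1,\ldots,x_n,t]$ be graded by $\deg x_i=0$ and $\deg t=1$. Let $T^n=(\mathbb{C}^\times)^n$ act on $R$ by graded $\mathbb{C}$-algebra automorphisms with $\lambda\cdot x_i=\lambda_i x_i$ and $\lambda\cdot t=\lambda_1^{\alpha_1}\cdots\lambda_n^{\alpha_n}\,t$ for $\lambda=(\lambda_1,\ldots,\lambda_n)\in T^n$. Let $G\subseteq T^n$ be an algebraic subgroup, let $\Delta$ be the polyhedron associated to $(G,\alpha)$, and let $S_\Delta$ be the semigroup of lattice points in the cone $C_\Delta$ over $\Delta$. Then $R^G\cong\mathbb{C}[S_\Delta]$ as graded rings, where $R^G$ is the subring of $G$-invariant elements of $R$.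
   Context: Let $T=T^n/G$, and let $\mathfrak{g}$, $\mathfrak{t}^n$, $\mathfrak{t}$ be the complex Lie algebras of $G$, $T^n$, $T$, so that there is an exact sequence $0\to\mathfrak{g}\to\mathfrak{t}^n\to\mathfrak{t}\to0$. Let $e_1,\ldots,e_n$ be the coordinate vectors of $\mathfrak{t}^n$ and let $a_i\in\mathfrak{t}$ be the image of $e_i$. The vector space $\mathfrak{t}$ carries the integer lattice $\mathfrak{t}_{\mathbb{Z}}=\ker(\exp:\mathfrak{t}\to T)$, where $\exp$ is normalized so that the corresponding lattice of $\mathfrak{t}^n$ is $\mathbb{Z}\{e_1,\ldots,e_n\}$; thus $a_i\in\mathfrak{t}_{\mathbb{Z}}$. The dual space $\mathfrak{t}^*$ has the dual lattice $\mathfrak{t}^*_{\mathbb{Z}}$ and the real part $\mathfrak{t}^*_{\mathbb{R}}=\mathfrak{t}^*_{\mathbb{Z}}\otimes_{\mathbb{Z}}\mathbb{R}$. The polyhedron is $\Delta=\{p\in\mathfrak{t}^*_{\mathbb{R}}\mid p\cdot a_i\ge\alpha_i\text{ for all }i\}$. The cone over $\Delta$ is $$C_\Delta=\{(p,r)\in\mathfrak{t}^*_{\mathbb{R}}\times\mathbb{R}\mid r\ge0\text{ and }p\in r\cdot\Delta\}^{cl},$$ where $cl$ denotes closure inside $\mathfrak{t}^*_{\mathbb{R}}\times\mathbb{R}$ and $r\cdot\Delta$ is the dilate of $\Delta$ by $r$. The semigroup is $S_\Delta=C_\Delta\cap(\mathfrak{t}^*_{\mathbb{Z}}\times\mathbb{Z})$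 under addition. The semigroup ring $\mathbb{C}[S_\Delta]$ is the $\mathbb{C}$-algebra with additive basis indexed by the elements of $S_\Delta$ and multiplication given by the semigroup law; it is graded by giving the basis element of $(p,r)$ degree $r$. The ring $R^G$ carries the grading inherited from $R$.
   Formalization: The polyhedron Δ is assumed to be nonempty: if Δ is empty then C_Δ and S_Δ are empty, so ℂ[S_Δ] = 0, while R^G contains ℂ, and the claim fails (e.g. n = 1, G = T^1, α = 1). *)

theory Defs
  imports
    "HOL-Analysis.Analysis"
    "HOL-Library.Poly_Mapping"
    "HOL-Library.Function_Algebras"
    "HOL-Algebra.Coset"
    "HOL-Algebra.QuotRing"
begin

section \<open>The torus and its algebraic subgroups\<close>

text \<open>Multiplication and the unit of \<^typ>\<open>complex^'n\<close> are componentwise.\<close>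

definition torus :: "(complex^'n) monoid" where
  "torus = \<lparr>carrier = {l. \<forall>i. l $ i \<noteq> 0}, monoid.mult = (*), one = 1\<rparr>"

text \<open>The regular functions on the torus are the Laurent polynomials; a Laurent polynomial is
  a finitely supported family of coefficients indexed by exponent vectors.\<close>

definition laurent_eval :: "((int^'n) \<Rightarrow>\<^sub>0 complex) \<Rightarrow> complex^'n \<Rightarrow> complex" where
  "laurent_eval f l = (\<Sum>m\<in>Poly_Mapping.keys f. Poly_Mapping.lookup f m * (\<Prod>i\<in>UNIV. (l $ i) powi (m $ i)))"

definition algebraic_subgroup :: "(complex^'n) set \<Rightarrow> bool" where
  "algebraic_subgroup G \<longleftrightarrow>
     subgroup G torus \<and> (\<exists>F. G = {l \<in> carrier torus. \<forall>f\<in>F. laurent_eval f l = 0})"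


section \<open>Lie algebras, lattices and duals\<close>

definition lie_torus :: "(complex^'n) monoid" where
  "lie_torus = \<lparr>carrier = UNIV, monoid.mult = (+), one = 0\<rparr>"

text \<open>Normalized so that its kernel is the lattice of integer vectors.\<close>

definition torus_exp :: "complex^'n \<Rightarrow> complex^'n" where
  "torus_exp v = (\<chi> i. exp (2 * of_real pi * \<i> * v $ i))"

text \<open>The complex Lie algebra of \<open>G\<close>, as the vectors generating a complex one-parameter subgroup
  of \<open>G\<close>.\<close>

definition lie_alg :: "(complex^'n) set \<Rightarrow> (complex^'n) set" where
  "lie_alg G = {v. \<forall>z. torus_exp (z *s v) \<in> G}"

text \<open>The Lie algebra of \<open>torus Mod G\<close>, as the quotient of the Lie algebra of the torus by that
  of \<open>G\<close>; its elements are cosets, and \<open>quot_proj G\<close> is the quotient map.\<close>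

definition quot_lie :: "(complex^'n) set \<Rightarrow> ((complex^'n) set) monoid" where
  "quot_lie G = lie_torus Mod lie_alg G"

definition quot_proj :: "(complex^'n) set \<Rightarrow> complex^'n \<Rightarrow> (complex^'n) set" where
  "quot_proj G v = lie_alg G #>\<^bsub>lie_torus\<^esub> v"

definition quot_vec :: "(complex^'n) set \<Rightarrow> 'n \<Rightarrow> (complex^'n) set" where
  "quot_vec G i = quot_proj G (axis i 1)"

text \<open>The exponential map of \<open>torus Mod G\<close>: the map induced by \<^const>\<open>torus_exp\<close> on cosets.\<close>

definition quot_exp :: "(complex^'n) set \<Rightarrow> (complex^'n) set \<Rightarrow> (complex^'n) set" where
  "quot_exp G X = the_elem ((\<lambda>v. G #>\<^bsub>torus\<^esub> torus_exp v) ` X)"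

definition quot_lattice :: "(complex^'n) set \<Rightarrow> (complex^'n) set set" where
  "quot_lattice G = kernel (quot_lie G) (torus Mod G) (quot_exp G)"

text \<open>The complex dual of \<^const>\<open>quot_lie\<close>. Functionals are set to \<open>0\<close> on sets that are not
  cosets, so that pointwise addition of functions is addition in the dual. Scalar multiplication
  on the quotient is the one induced from \<^typ>\<open>complex^'n\<close>.\<close>

definition quot_dual :: "(complex^'n) set \<Rightarrow> ((complex^'n) set \<Rightarrow> complex) set" where
  "quot_dual G = {p.
     (\<forall>X\<in>carrier (quot_lie G). \<forall>Y\<in>carrier (quot_lie G). p (X \<otimes>\<^bsub>quot_lie G\<^esub> Y) = p X + p Y) \<and>
     (\<forall>c v. p (quot_proj G (c *s v)) = c * p (quot_proj G v)) \<and>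
     (\<forall>X. X \<notin> carrier (quot_lie G) \<longrightarrow> p X = 0)}"

definition dual_lattice :: "(complex^'n) set \<Rightarrow> ((complex^'n) set \<Rightarrow> complex) set" where
  "dual_lattice G = {p \<in> quot_dual G. \<forall>X\<in>quot_lattice G. p X \<in> \<int>}"

text \<open>The tensor product of the dual lattice with the reals, realized as the real span inside the
  complex dual; this is faithful because a lattice basis is a complex basis of the dual.\<close>

definition dual_real :: "(complex^'n) set \<Rightarrow> ((complex^'n) set \<Rightarrow> complex) set" where
  "dual_real G = {(\<lambda>X. \<Sum>q\<in>A. of_real (c q) * q X) | A c. finite A \<and> A \<subseteq> dual_lattice G}"


section \<open>The polyhedron, its cone and the semigroup\<close>

text \<open>Elements of \<^const>\<open>dual_real\<close> take real values on the vectors \<^const>\<open>quot_vec\<close>, which lie in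
  the lattice; \<^const>\<open>Re\<close> only changes the type of these values.\<close>

definition assoc_polyhedron :: "(complex^'n) set \<Rightarrow> int^'n \<Rightarrow> ((complex^'n) set \<Rightarrow> complex) set" where
  "assoc_polyhedron G \<alpha> = {p \<in> dual_real G. \<forall>i. Re (p (quot_vec G i)) \<ge> of_int (\<alpha> $ i)}"

definition dilate :: "real \<Rightarrow> ('a \<Rightarrow> complex) set \<Rightarrow> ('a \<Rightarrow> complex) set" where
  "dilate r D = (\<lambda>p X. of_real r * p X) ` D"

text \<open>The function type carries the topology of pointwise convergence, which induces the Euclidean
  topology on the finite-dimensional real vector space \<^const>\<open>dual_real\<close>.\<close>

definition cone_over ::
  "(complex^'n) set \<Rightarrow> int^'n \<Rightarrow> (((complex^'n) set \<Rightarrow> complex) \<times> real) set" where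
  "cone_over G \<alpha> =
     top_of_set (dual_real G \<times> UNIV) closure_of {(p, r). r \<ge> 0 \<and> p \<in> dilate r (assoc_polyhedron G \<alpha>)}"

definition cone_semigroup ::
  "(complex^'n) set \<Rightarrow> int^'n \<Rightarrow> (((complex^'n) set \<Rightarrow> complex) \<times> int) set" where
  "cone_semigroup G \<alpha> = {(p, k). p \<in> dual_lattice G \<and> (p, of_int k) \<in> cone_over G \<alpha>}"


section \<open>Rings and gradings\<close>

text \<open>For a commutative monoid \<open>M\<close>, written additively, \<^typ>\<open>'M \<Rightarrow>\<^sub>0 complex\<close> is its monoid algebra:
  the basis elements are the \<open>Poly_Mapping.single m 1\<close>, and multiplication is convolution.\<close>

definition ring_on :: "'a::ring_1 set \<Rightarrow> 'a ring" where
  "ring_on A = \<lparr>carrier = A, monoid.mult = (*), one = 1, zero = 0, add = (+)\<rparr>"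

definition graded_ring_iso ::
  "'a ring \<Rightarrow> (int \<Rightarrow> 'a set) \<Rightarrow> 'b ring \<Rightarrow> (int \<Rightarrow> 'b set) \<Rightarrow> bool" where
  "graded_ring_iso A gA B gB \<longleftrightarrow> (\<exists>h \<in> ring_iso A B. \<forall>d. h ` gA d = gB d)"

definition semigroup_ring ::
  "(((complex^'n) set \<Rightarrow> complex) \<times> int) set \<Rightarrow>
   ((((complex^'n) set \<Rightarrow> complex) \<times> int) \<Rightarrow>\<^sub>0 complex) ring" where
  "semigroup_ring S = ring_on {f. Poly_Mapping.keys f \<subseteq> S}"

definition semigroup_ring_part ::
  "(((complex^'n) set \<Rightarrow> complex) \<times> int) set \<Rightarrow> int \<Rightarrow>
   ((((complex^'n) set \<Rightarrow> complex) \<times> int) \<Rightarrow>\<^sub>0 complex) set" where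
  "semigroup_ring_part S d = {f. Poly_Mapping.keys f \<subseteq> {(p, k) \<in> S. k = d}}"


section \<open>The polynomial ring and its invariants\<close>

text \<open>Polynomials in the variables \<open>x\<^sub>i\<close>, encoded as \<open>Some i\<close>, and \<open>t\<close>, encoded as \<^const>\<open>None\<close>.
  Monomials are finitely supported exponent functions.\<close>

type_synonym 'n pol = "('n option \<Rightarrow>\<^sub>0 nat) \<Rightarrow>\<^sub>0 complex"

definition pconst :: "complex \<Rightarrow> 'n pol" where
  "pconst c = Poly_Mapping.single 0 c"

definition pvar :: "'n option \<Rightarrow> 'n pol" where
  "pvar v = Poly_Mapping.single (Poly_Mapping.single v 1) 1"

text \<open>The complex algebra endomorphism sending each variable \<open>v\<close> to \<open>s v\<close>.\<close>

definition psubst :: "('n::finite option \<Rightarrow> 'n pol) \<Rightarrow> 'n pol \<Rightarrow> 'n pol" where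
  "psubst s f =
     (\<Sum>m\<in>Poly_Mapping.keys f. pconst (Poly_Mapping.lookup f m) * (\<Prod>v\<in>UNIV. s v ^ Poly_Mapping.lookup m v))"

definition torus_act :: "int^'n \<Rightarrow> complex^'n \<Rightarrow> 'n::finite pol \<Rightarrow> 'n pol" where
  "torus_act \<alpha> l = psubst (\<lambda>v. case v of
       Some i \<Rightarrow> pconst (l $ i) * pvar (Some i)
     | None \<Rightarrow> pconst (\<Prod>i\<in>UNIV. (l $ i) powi (\<alpha> $ i)) * pvar None)"

definition invariants :: "(complex^'n) set \<Rightarrow> int^'n \<Rightarrow> 'n::finite pol set" where
  "invariants G \<alpha> = {f. \<forall>l\<in>G. torus_act \<alpha> l f = f}"

definition invariant_ring :: "(complex^'n) set \<Rightarrow> int^'n \<Rightarrow> 'n::finite pol ring" where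
  "invariant_ring G \<alpha> = ring_on (invariants G \<alpha>)"

definition invariant_ring_part :: "(complex^'n) set \<Rightarrow> int^'n \<Rightarrow> int \<Rightarrow> 'n::finite pol set" where
  "invariant_ring_part G \<alpha> d =
     {f \<in> invariants G \<alpha>. \<forall>m\<in>Poly_Mapping.keys f. int (Poly_Mapping.lookup m None) = d}"

end

theory Submission
  imports Defs
begin

text \<open>The torus acts diagonally on monomials, so \<open>R\<^sup>G\<close> is spanned by the monomials
  \<open>x\<^sup>a t\<^sup>k\<close> whose character \<open>a + k \<alpha>\<close> is trivial on \<open>G\<close>. The characters trivial on \<open>G\<close> are the
  elements of the dual lattice of \<open>T\<close>, and under this identification the exponent of \<open>x\<^sub>i\<close>
  in the monomial belonging to \<open>(p, k)\<close> is the value of \<open>p\<close> on the image of \<open>e\<^sub>i\<close>, minus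
  \<open>k \<alpha>\<^sub>i\<close>. For \<open>k \<ge> 0\<close> these exponents are all nonnegative exactly when \<open>(p, k)\<close> lies in the cone.\<close>

section \<open>Transport of monoid algebras\<close>

text \<open>The pushforward of finitely supported coefficient families: coefficients of keys with
  the same image are added. For additive \<open>\<phi>\<close> it is the induced map of monoid
  algebras.\<close>

definition push_keys :: "('a \<Rightarrow> 'b) \<Rightarrow> ('a \<Rightarrow>\<^sub>0 'c::comm_monoid_add) \<Rightarrow> ('b \<Rightarrow>\<^sub>0 'c)" where
  "push_keys \<phi> f = (\<Sum>m\<in>Poly_Mapping.keys f. Poly_Mapping.single (\<phi> m) (Poly_Mapping.lookup f m))"

lemma push_keys_superset:
  assumes "finite A" "Poly_Mapping.keys f \<subseteq> A"
  shows "push_keys \<phi> f = (\<Sum>m\<in>A. Poly_Mapping.single (\<phi> m) (Poly_Mapping.lookup f m))"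
  unfolding push_keys_def
  by (rule sum.mono_neutral_left) (use assms in \<open>auto simp: in_keys_iff\<close>)

lemma push_keys_zero [simp]: "push_keys \<phi> 0 = 0"
  by (simp add: push_keys_def)

lemma push_keys_add: "push_keys \<phi> (f + g) = push_keys \<phi> f + push_keys \<phi> g"
proof -
  let ?A = "Poly_Mapping.keys f \<union> Poly_Mapping.keys g"
  have "push_keys \<phi> h = (\<Sum>m\<in>?A. Poly_Mapping.single (\<phi> m) (Poly_Mapping.lookup h m))"
    if "h \<in> {f, g, f + g}" for h
    by (rule push_keys_superset) (use that keys_add[of f g] in auto)
  then show ?thesis
    by (simp add: lookup_add single_add sum.distrib)
qed

lemma push_keys_sum: "push_keys \<phi> (sum F A) = (\<Sum>a\<in>A. push_keys \<phi> (F a))"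
  by (induction A rule: infinite_finite_induct) (simp_all add: push_keys_add)

lemma push_keys_single: "push_keys \<phi> (Poly_Mapping.single m c) = Poly_Mapping.single (\<phi> m) c"
  by (simp add: push_keys_def)

text \<open>The hypothesis concerns only the support, since a map composed with a partial inverse is
  known to be the identity just on a subset.\<close>

lemma push_keys_ident:
  assumes "\<And>m. m \<in> Poly_Mapping.keys f \<Longrightarrow> \<phi> m = m"
  shows "push_keys \<phi> f = f"
proof (rule poly_mapping_eqI)
  fix k
  have "push_keys \<phi> f = (\<Sum>m\<in>Poly_Mapping.keys f. Poly_Mapping.single m (Poly_Mapping.lookup f m))"
    unfolding push_keys_def using assms by (intro sum.cong) auto
  then show "Poly_Mapping.lookup (push_keys \<phi> f) k = Poly_Mapping.lookup f k"
    by (simp add: lookup_sum lookup_single when_def in_keys_iff)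
qed

lemma push_keys_push_keys: "push_keys \<phi> (push_keys \<psi> f) = push_keys (\<phi> \<circ> \<psi>) f"
  by (simp add: push_keys_def[of \<psi>] push_keys_def[of "\<phi> \<circ> \<psi>"] push_keys_sum push_keys_single)

lemma keys_push_keys: "Poly_Mapping.keys (push_keys \<phi> f) \<subseteq> \<phi> ` Poly_Mapping.keys f"
  unfolding push_keys_def by (rule order_trans[OF keys_sum]) auto

text \<open>Both sides expand into the same double sum of monomials. Additivity is asked on the
  whole monoid, so the map of exponents used later has to be total and additive everywhere.\<close>

lemma push_keys_mult:
  fixes f g :: "'a::monoid_add \<Rightarrow>\<^sub>0 'c::semiring_0"
  assumes "\<And>a b. \<phi> (a + b) = \<phi> a + \<phi> b"
  shows "push_keys \<phi> (f * g) = push_keys \<phi> f * push_keys \<phi> g"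
proof -
  have expand: "h = (\<Sum>m\<in>Poly_Mapping.keys h. Poly_Mapping.single m (Poly_Mapping.lookup h m))"
    for h :: "'a \<Rightarrow>\<^sub>0 'c"
    using push_keys_ident[of h id] by (simp add: push_keys_def)
  have "f * g = (\<Sum>m\<in>Poly_Mapping.keys f. \<Sum>l\<in>Poly_Mapping.keys g.
      Poly_Mapping.single (m + l) (Poly_Mapping.lookup f m * Poly_Mapping.lookup g l))"
    by (subst expand[of f], subst expand[of g]) (simp add: sum_product mult_single)
  then show ?thesis
    by (simp add: push_keys_sum push_keys_single assms push_keys_def[of \<phi> f] push_keys_def[of \<phi> g]
        sum_product mult_single)
qed

text \<open>The inverse is the pushforward along \<open>inv_into M \<phi>\<close>. Injectivity is
  asked on \<open>M\<close> alone because it will be available only on the invariant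
  monomials.\<close>

lemma bij_betw_push_keys:
  fixes \<phi> :: "'a \<Rightarrow> 'b"
  assumes "inj_on \<phi> M"
  shows "bij_betw (push_keys \<phi>) {f :: 'a \<Rightarrow>\<^sub>0 'c::comm_monoid_add. Poly_Mapping.keys f \<subseteq> M}
    {g. Poly_Mapping.keys g \<subseteq> \<phi> ` M}"
proof (rule bij_betw_byWitness[where f' = "push_keys (inv_into M \<phi>)"])
  let ?\<psi> = "inv_into M \<phi>"
  show "\<forall>f\<in>{f :: 'a \<Rightarrow>\<^sub>0 'c. Poly_Mapping.keys f \<subseteq> M}. push_keys ?\<psi> (push_keys \<phi> f) = f"
    using assms by (auto simp: push_keys_push_keys subset_iff intro!: push_keys_ident)
  show "\<forall>g\<in>{g :: 'b \<Rightarrow>\<^sub>0 'c. Poly_Mapping.keys g \<subseteq> \<phi> ` M}. push_keys \<phi> (push_keys ?\<psi> g) = g"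
  proof clarify
    fix g :: "'b \<Rightarrow>\<^sub>0 'c" assume "Poly_Mapping.keys g \<subseteq> \<phi> ` M"
    then have "(\<phi> \<circ> ?\<psi>) k = k" if "k \<in> Poly_Mapping.keys g" for k
      using that by (metis comp_apply f_inv_into_f subsetD)
    then show "push_keys \<phi> (push_keys ?\<psi> g) = g"
      unfolding push_keys_push_keys by (rule push_keys_ident)
  qed
  show "push_keys \<phi> ` {f :: 'a \<Rightarrow>\<^sub>0 'c. Poly_Mapping.keys f \<subseteq> M} \<subseteq> {g. Poly_Mapping.keys g \<subseteq> \<phi> ` M}"
    using keys_push_keys[of \<phi>] by blast
  show "push_keys ?\<psi> ` {g :: 'b \<Rightarrow>\<^sub>0 'c. Poly_Mapping.keys g \<subseteq> \<phi> ` M} \<subseteq> {f. Poly_Mapping.keys f \<subseteq> M}"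
  proof safe
    fix g :: "'b \<Rightarrow>\<^sub>0 'c" and x assume g: "Poly_Mapping.keys g \<subseteq> \<phi> ` M"
      and x: "x \<in> Poly_Mapping.keys (push_keys ?\<psi> g)"
    then obtain k where "k \<in> Poly_Mapping.keys g" "x = ?\<psi> k"
      using keys_push_keys[of ?\<psi> g] by blast
    then show "x \<in> M"
      using g by (auto intro: inv_into_into)
  qed
qed


section \<open>Characters and functionals\<close>

definition character :: "int^'n \<Rightarrow> complex^'n \<Rightarrow> complex" where
  "character m l = (\<Prod>i\<in>UNIV. (l $ i) powi (m $ i))"

definition pairing :: "int^'n \<Rightarrow> complex^'n \<Rightarrow> complex" where
  "pairing m v = (\<Sum>i\<in>UNIV. of_int (m $ i) * v $ i)"

text \<open>The annihilator of \<open>G\<close> in the character lattice of the torus: the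
  characters that descend to \<open>torus Mod G\<close>.\<close>

definition trivial_characters :: "(complex^'n) set \<Rightarrow> (int^'n) set" where
  "trivial_characters G = {m. \<forall>l\<in>G. character m l = 1}"

text \<open>Through this formula triviality of a character becomes integrality of a pairing.\<close>

lemma character_exp: "character m (torus_exp v) = exp (2 * of_real pi * \<i> * pairing m v)"
  by (simp add: character_def torus_exp_def pairing_def exp_power_int exp_sum sum_distrib_left
      algebra_simps)

lemma pairing_simps:
  "pairing (m + m') v = pairing m v + pairing m' v"
  "pairing m (v + w) = pairing m v + pairing m w"
  "pairing m (v - w) = pairing m v - pairing m w"
  "pairing m (c *s v) = c * pairing m v"
  "pairing 0 v = 0"
  by (simp_all add: pairing_def algebra_simps sum.distrib sum_subtractf sum_distrib_left)

lemma pairing_axis: "pairing m (axis i 1) = of_int (m $ i)"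
  by (simp add: pairing_def axis_def if_distrib cong: if_cong)

lemma exp_2pi_i_eq_1_iff: "exp (2 * of_real pi * \<i> * z) = 1 \<longleftrightarrow> z \<in> \<int>"
proof
  assume "exp (2 * of_real pi * \<i> * z) = 1"
  then obtain n :: int where "Re (2 * of_real pi * \<i> * z) = 0"
      "Im (2 * of_real pi * \<i> * z) = of_int (2 * n) * pi"
    by (auto simp: exp_eq_1)
  then have "z = of_int n"
    by (auto simp: complex_eq_iff)
  then show "z \<in> \<int>"
    by simp
next
  assume "z \<in> \<int>"
  then obtain n where "z = of_int n"
    by (auto elim: Ints_cases)
  then show "exp (2 * of_real pi * \<i> * z) = 1"
    by (auto simp: exp_eq_1)
qed

section \<open>The exponential map and the Lie algebra of \<open>G\<close>\<close>

lemma torus_exp_add: "torus_exp (v + w) = torus_exp v * torus_exp w"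
  by (simp add: torus_exp_def vec_eq_iff algebra_simps exp_add)

lemma torus_exp_in_torus: "torus_exp v \<in> carrier torus"
  by (simp add: torus_exp_def torus_def)

lemma torus_exp_surj:
  assumes "l \<in> carrier torus"
  obtains v where "torus_exp v = l"
proof
  show "torus_exp (\<chi> i. Ln (l $ i) / (2 * of_real pi * \<i>)) = l"
    using assms by (simp add: torus_exp_def torus_def vec_eq_iff)
qed

lemma torus_comm_group: "comm_group (torus :: (complex^'n) monoid)"
proof (rule comm_groupI)
  fix x :: "complex^'n" assume "x \<in> carrier torus"
  then show "\<exists>y\<in>carrier torus. y \<otimes>\<^bsub>torus\<^esub> x = \<one>\<^bsub>torus\<^esub>"
    by (intro bexI[of _ "\<chi> i. inverse (x $ i)"]) (auto simp: torus_def vec_eq_iff)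
qed (auto simp: torus_def algebra_simps)

lemma lie_torus_comm_group: "comm_group (lie_torus :: (complex^'n) monoid)"
proof (rule comm_groupI)
  fix x :: "complex^'n" assume "x \<in> carrier lie_torus"
  then show "\<exists>y\<in>carrier lie_torus. y \<otimes>\<^bsub>lie_torus\<^esub> x = \<one>\<^bsub>lie_torus\<^esub>"
    by (intro bexI[of _ "- x"]) (auto simp: lie_torus_def)
qed (auto simp: lie_torus_def algebra_simps)

lemma lie_alg_zero:
  fixes G :: "(complex^'n) set"
  assumes "subgroup G torus"
  shows "0 \<in> lie_alg G"
proof -
  have "torus_exp (z *s 0) = (1 :: complex^'n)" for z
    by (simp add: torus_exp_def vec_eq_iff)
  then show ?thesis
    using subgroup.one_closed[OF assms] by (simp add: lie_alg_def torus_def)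
qed

lemma lie_alg_add:
  assumes "subgroup G torus" "v \<in> lie_alg G" "w \<in> lie_alg G"
  shows "v + w \<in> lie_alg G"
  using subgroup.m_closed[OF assms(1)] assms(2,3)
  by (auto simp: lie_alg_def torus_def vector_add_ldistrib torus_exp_add)

lemma lie_alg_uminus:
  assumes "v \<in> lie_alg G"
  shows "- v \<in> lie_alg G"
proof -
  have "z *s (- v) = (- z) *s v" for z
    by (simp add: vec_eq_iff)
  then show ?thesis
    using assms by (simp only: lie_alg_def mem_Collect_eq) blast
qed

lemma lie_alg_exp:
  assumes "v \<in> lie_alg G"
  shows "torus_exp v \<in> G"
proof -
  have "torus_exp (1 *s v) \<in> G"
    using assms by (simp only: lie_alg_def mem_Collect_eq)
  then show ?thesis
    by simp
qed

lemma lie_alg_normal: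
  fixes G :: "(complex^'n) set"
  assumes "subgroup G torus"
  shows "lie_alg G \<lhd> lie_torus"
proof -
  interpret L: comm_group "lie_torus :: (complex^'n) monoid"
    by (rule lie_torus_comm_group)
  have inv: "inv\<^bsub>lie_torus\<^esub> v = - v" for v :: "complex^'n"
    by (rule L.inv_equality) (auto simp: lie_torus_def)
  have "subgroup (lie_alg G) lie_torus"
  proof (rule L.subgroupI)
    show "lie_alg G \<noteq> {}"
      using lie_alg_zero[OF assms] by blast
  next
    fix v assume "v \<in> lie_alg G"
    then show "inv\<^bsub>lie_torus\<^esub> v \<in> lie_alg G"
      by (simp add: inv lie_alg_uminus)
  qed (simp_all add: lie_torus_def lie_alg_add[OF assms])
  then show ?thesis
    by (simp add: L.normal_iff_subgroup)
qed

section \<open>The quotient Lie algebra and its lattice\<close>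

lemma mem_quot_proj: "w \<in> quot_proj G v \<longleftrightarrow> w - v \<in> lie_alg G"
  by (force simp: quot_proj_def r_coset_def lie_torus_def)

lemma carrier_quot_lie: "carrier (quot_lie G) = range (quot_proj G)"
  by (auto simp: quot_lie_def FactGroup_def RCOSETS_def quot_proj_def lie_torus_def)

lemma quot_proj_in_carrier [simp]: "quot_proj G v \<in> carrier (quot_lie G)"
  by (simp add: carrier_quot_lie)

lemma quot_proj_add:
  assumes "subgroup G torus"
  shows "quot_proj G v \<otimes>\<^bsub>quot_lie G\<^esub> quot_proj G w = quot_proj G (v + w)"
  using normal.rcos_sum[OF lie_alg_normal[OF assms], of v w]
  by (simp add: quot_lie_def FactGroup_def quot_proj_def lie_torus_def)

text \<open>Two representatives differ by an element of \<open>lie_alg G\<close>, whose exponential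
  lies in \<open>G\<close>; so the set under \<open>the_elem\<close> is a singleton.\<close>

lemma quot_exp_proj:
  fixes G :: "(complex^'n) set"
  assumes "subgroup G torus"
  shows "quot_exp G (quot_proj G v) = G #>\<^bsub>torus\<^esub> torus_exp v"
proof -
  interpret T: comm_group "torus :: (complex^'n) monoid"
    by (rule torus_comm_group)
  have "G #>\<^bsub>torus\<^esub> torus_exp w = G #>\<^bsub>torus\<^esub> torus_exp v" if "w \<in> quot_proj G v" for w
  proof -
    have h: "torus_exp (w - v) \<in> G"
      using that by (simp add: mem_quot_proj lie_alg_exp)
    have "torus_exp w = torus_exp (w - v) \<otimes>\<^bsub>torus\<^esub> torus_exp v"
      by (simp add: torus_def flip: torus_exp_add)
    then have "G #>\<^bsub>torus\<^esub> torus_exp w = (G #>\<^bsub>torus\<^esub> torus_exp (w - v)) #>\<^bsub>torus\<^esub> torus_exp v"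
      using T.coset_mult_assoc subgroup.subset[OF assms] torus_exp_in_torus by metis
    then show ?thesis
      by (simp add: T.coset_join2[OF torus_exp_in_torus assms h])
  qed
  moreover have "v \<in> quot_proj G v"
    by (simp add: mem_quot_proj lie_alg_zero[OF assms])
  ultimately have "(\<lambda>w. G #>\<^bsub>torus\<^esub> torus_exp w) ` quot_proj G v = {G #>\<^bsub>torus\<^esub> torus_exp v}"
    by blast
  then show ?thesis
    by (simp add: quot_exp_def)
qed

text \<open>The unit of \<open>torus Mod G\<close> is \<open>G\<close> itself. For disconnected
  \<open>G\<close> the lattice can be strictly larger than the image of the integer vectors, for
  instance for a nontrivial finite \<open>G\<close>.\<close>

lemma quot_proj_in_lattice:
  fixes G :: "(complex^'n) set"
  assumes "subgroup G torus"
  shows "quot_proj G v \<in> quot_lattice G \<longleftrightarrow> torus_exp v \<in> G"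
proof -
  interpret T: comm_group "torus :: (complex^'n) monoid"
    by (rule torus_comm_group)
  have "quot_proj G v \<in> quot_lattice G \<longleftrightarrow> G #>\<^bsub>torus\<^esub> torus_exp v = G"
    by (simp add: quot_lattice_def kernel_def quot_exp_proj[OF assms] FactGroup_def)
  then show ?thesis
    using T.coset_join1 T.coset_join2 assms torus_exp_in_torus by metis
qed

lemma quot_lattice_subset: "quot_lattice G \<subseteq> carrier (quot_lie G)"
  by (auto simp: quot_lattice_def kernel_def)

section \<open>The dual lattice as the lattice of trivial characters\<close>

text \<open>Choosing representatives makes the functional additive in \<open>m\<close> for all \<open>m\<close>, although it is
  meaningful only when \<open>m\<close> is trivial on \<open>G\<close>.\<close>

definition char_functional :: "(complex^'n) set \<Rightarrow> int^'n \<Rightarrow> (complex^'n) set \<Rightarrow> complex" where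
  "char_functional G m X = (if X \<in> carrier (quot_lie G) then pairing m (SOME v. v \<in> X) else 0)"

lemma char_functional_add:
  "char_functional G (m + m') = char_functional G m + char_functional G m'"
  by (auto simp: fun_eq_iff char_functional_def pairing_simps)

lemma char_functional_zero: "char_functional G 0 = 0"
  by (auto simp: fun_eq_iff char_functional_def pairing_simps)

text \<open>The character is trivial along the whole complex line through \<open>v\<close>, which
  forces its differential to vanish there.\<close>

lemma pairing_lie_alg:
  assumes "m \<in> trivial_characters G" "v \<in> lie_alg G"
  shows "pairing m v = 0"
proof (rule ccontr)
  assume nz: "pairing m v \<noteq> 0"
  \<comment> \<open>The multiple of \<open>v\<close> is chosen to have pairing 1/2, where the
    character would be -1.\<close>
  have "character m (torus_exp ((1 / (2 * pairing m v)) *s v)) = 1"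
    using assms by (auto simp: trivial_characters_def lie_alg_def)
  then have "(1 / 2 :: complex) \<in> \<int>"
    unfolding character_exp exp_2pi_i_eq_1_iff using nz by (simp add: pairing_simps)
  then obtain k where "(1 / 2 :: complex) = of_int k"
    by (auto elim: Ints_cases)
  then have "(of_int (2 * k) :: complex) = of_int 1"
    by (simp add: field_simps)
  then have "2 * k = 1"
    by (simp only: of_int_eq_iff)
  then show False
    by presburger
qed

text \<open>The chosen representative differs from \<open>v\<close> by an element of
  \<open>lie_alg G\<close>, on which the pairing vanishes.\<close>

lemma char_functional_proj:
  assumes "subgroup G torus" "m \<in> trivial_characters G"
  shows "char_functional G m (quot_proj G v) = pairing m v"
proof -
  have "v \<in> quot_proj G v"
    by (simp add: mem_quot_proj lie_alg_zero[OF assms(1)])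
  then have "(SOME w. w \<in> quot_proj G v) \<in> quot_proj G v"
    by (rule someI)
  then have "pairing m ((SOME w. w \<in> quot_proj G v) - v) = 0"
    by (intro pairing_lie_alg[OF assms(2)]) (simp add: mem_quot_proj)
  then show ?thesis
    by (simp add: char_functional_def pairing_simps)
qed

lemma char_functional_in_dual_lattice:
  fixes G :: "(complex^'n) set"
  assumes "subgroup G torus" "m \<in> trivial_characters G"
  shows "char_functional G m \<in> dual_lattice G"
proof -
  note P = char_functional_proj[OF assms]
  have "char_functional G m X \<in> \<int>" if "X \<in> quot_lattice G" for X
  proof -
    have "X \<in> range (quot_proj G)"
      using that quot_lattice_subset[of G] unfolding carrier_quot_lie by blast
    then obtain v where v: "X = quot_proj G v" ..
    then have "torus_exp v \<in> G"
      using that quot_proj_in_lattice[OF assms(1)] by simp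
    then have "character m (torus_exp v) = 1"
      using assms(2) by (simp add: trivial_characters_def)
    then show ?thesis
      by (simp add: v P character_exp exp_2pi_i_eq_1_iff)
  qed
  then show ?thesis
    by (auto simp: dual_lattice_def quot_dual_def carrier_quot_lie quot_proj_add[OF assms(1)] P
        pairing_simps) (simp add: char_functional_def carrier_quot_lie)
qed

text \<open>The images of the coordinate vectors span the quotient.\<close>

lemma quot_dual_sum:
  fixes G :: "(complex^'n) set"
  assumes "subgroup G torus" "p \<in> quot_dual G"
  shows "p (quot_proj G v) = (\<Sum>i\<in>UNIV. v $ i * p (quot_vec G i))"
proof -
  have add: "p (quot_proj G (v + w)) = p (quot_proj G v) + p (quot_proj G w)" for v w
    using assms(2) quot_proj_add[OF assms(1), symmetric] by (simp add: quot_dual_def)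
  have scale: "p (quot_proj G (c *s v)) = c * p (quot_proj G v)" for c v
    using assms(2) by (simp add: quot_dual_def)
  have zero: "p (quot_proj G 0) = 0"
    using scale[of 0 0] by simp
  have "p (quot_proj G (sum f A)) = (\<Sum>i\<in>A. p (quot_proj G (f i)))" for f and A :: "'n set"
    by (induction A rule: infinite_finite_induct) (simp_all add: add zero)
  from this[of "\<lambda>i. v $ i *s axis i 1" UNIV] show ?thesis
    by (simp add: basis_expansion scale quot_vec_def)
qed

text \<open>The exponents of the character are the values of \<open>p\<close> on the images of the
  coordinate vectors. Integrality of \<open>p\<close> on the lattice is used twice: it makes these
  values integers, and it makes the character trivial on \<open>G\<close>.\<close>

lemma dual_lattice_eq_char_functional:
  fixes G :: "(complex^'n) set"
  assumes "subgroup G torus" "p \<in> dual_lattice G"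
  obtains m where "m \<in> trivial_characters G" "p = char_functional G m"
proof -
  have dual: "p \<in> quot_dual G"
    using assms(2) by (simp add: dual_lattice_def)
  \<comment> \<open>By the normalization of the exponential, coordinate vectors are in its kernel,
    so their images are lattice elements.\<close>
  have "torus_exp (axis i 1) = (1 :: complex^'n)" for i
    by (auto simp: torus_exp_def axis_def vec_eq_iff exp_eq_1)
  then have "quot_vec G i \<in> quot_lattice G" for i
    using subgroup.one_closed[OF assms(1)]
    by (simp add: quot_vec_def quot_proj_in_lattice[OF assms(1)] torus_def)
  then have "\<forall>i. \<exists>k. p (quot_vec G i) = of_int k"
    using assms(2) unfolding dual_lattice_def Ints_def by blast
  then obtain f where f: "p (quot_vec G i) = of_int (f i)" for i
    by metis
  define m :: "int^'n" where "m = (\<chi> i. f i)"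
  have p: "p (quot_proj G v) = pairing m v" for v
    by (simp add: quot_dual_sum[OF assms(1) dual] f pairing_def m_def mult.commute)
  have triv: "m \<in> trivial_characters G"
  proof -
    have "character m l = 1" if "l \<in> G" for l
    proof -
      have "l \<in> carrier torus"
        using that subgroup.subset[OF assms(1)] by blast
      \<comment> \<open>Every element of \<open>G\<close>, even outside the identity component, has
        a logarithm in the Lie algebra of the full torus, and its coset is a lattice
        element.\<close>
      then obtain v where v: "torus_exp v = l"
        by (rule torus_exp_surj)
      then have "quot_proj G v \<in> quot_lattice G"
        using that by (simp add: quot_proj_in_lattice[OF assms(1)])
      then have "pairing m v \<in> \<int>"
        using assms(2) by (auto simp: dual_lattice_def simp flip: p)
      then show ?thesis
        by (simp add: character_exp exp_2pi_i_eq_1_iff flip: v)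
    qed
    then show ?thesis
      by (simp add: trivial_characters_def)
  qed
  have "p X = char_functional G m X" for X
  proof (cases "X \<in> carrier (quot_lie G)")
    case True
    then show ?thesis
      by (auto simp: carrier_quot_lie p char_functional_proj[OF assms(1) triv])
  next
    case False
    then show ?thesis
      using dual by (simp add: quot_dual_def char_functional_def)
  qed
  then show ?thesis
    using triv that by blast
qed

lemma char_functional_vec:
  assumes "subgroup G torus" "m \<in> trivial_characters G"
  shows "char_functional G m (quot_vec G i) = of_int (m $ i)"
  by (simp add: quot_vec_def char_functional_proj[OF assms] pairing_axis)


section \<open>The cone\<close>

lemma dual_lattice_in_real: "p \<in> dual_lattice G \<Longrightarrow> p \<in> dual_real G"
  unfolding dual_real_def
  by (rule CollectI, rule exI[of _ "{p}"], rule exI[of _ "\<lambda>_. 1"]) auto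

lemma dual_real_scale:
  assumes "p \<in> dual_real G"
  shows "(\<lambda>X. of_real r * p X) \<in> dual_real G"
proof -
  obtain A c where A: "finite A" "A \<subseteq> dual_lattice G" "p = (\<lambda>X. \<Sum>q\<in>A. of_real (c q) * q X)"
    using assms by (auto simp: dual_real_def)
  then have "(\<lambda>X. of_real r * p X) = (\<lambda>X. \<Sum>q\<in>A. of_real (r * c q) * q X)"
    by (simp add: sum_distrib_left mult.assoc)
  with A(1,2) show ?thesis
    unfolding dual_real_def
    by (intro CollectI exI[of _ A] exI[of _ "\<lambda>q. r * c q"]) simp
qed

lemma dual_real_add:
  assumes "p \<in> dual_real G" "p' \<in> dual_real G"
  shows "(\<lambda>X. p X + p' X) \<in> dual_real G"
proof -
  obtain A c where A: "finite A" "A \<subseteq> dual_lattice G" "p = (\<lambda>X. \<Sum>q\<in>A. of_real (c q) * q X)"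
    using assms(1) by (auto simp: dual_real_def)
  obtain B d where B: "finite B" "B \<subseteq> dual_lattice G" "p' = (\<lambda>X. \<Sum>q\<in>B. of_real (d q) * q X)"
    using assms(2) by (auto simp: dual_real_def)
  \<comment> \<open>Padding with 0 puts both combinations over the index set
    \<open>A \<union> B\<close>.\<close>
  define c' d' where "c' q = (if q \<in> A then c q else 0)" and "d' q = (if q \<in> B then d q else 0)" for q
  have "p X = (\<Sum>q\<in>A \<union> B. of_real (c' q) * q X)" for X
    unfolding A(3) by (rule sum.mono_neutral_cong_left) (use A B in \<open>auto simp: c'_def\<close>)
  moreover have "p' X = (\<Sum>q\<in>A \<union> B. of_real (d' q) * q X)" for X
    unfolding B(3) by (rule sum.mono_neutral_cong_left) (use A B in \<open>auto simp: d'_def\<close>)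
  ultimately have "(\<lambda>X. p X + p' X) = (\<lambda>X. \<Sum>q\<in>A \<union> B. of_real (c' q + d' q) * q X)"
    by (simp add: sum.distrib distrib_right)
  with A(1,2) B(1,2) show ?thesis
    unfolding dual_real_def
    by (intro CollectI exI[of _ "A \<union> B"] exI[of _ "\<lambda>q. c' q + d' q"]) simp
qed

text \<open>Dilation by \<open>1 / r\<close> is the inverse. At \<open>r = 0\<close> the
  inequalities may have nonzero solutions, which the dilate does not contain.\<close>

lemma dilate_polyhedron:
  assumes "r > 0"
  shows "p \<in> dilate r (assoc_polyhedron G \<alpha>) \<longleftrightarrow>
    p \<in> dual_real G \<and> (\<forall>i. r * of_int (\<alpha> $ i) \<le> Re (p (quot_vec G i)))"
proof
  assume "p \<in> dilate r (assoc_polyhedron G \<alpha>)"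
  then show "p \<in> dual_real G \<and> (\<forall>i. r * of_int (\<alpha> $ i) \<le> Re (p (quot_vec G i)))"
    using assms by (auto simp: dilate_def assoc_polyhedron_def dual_real_scale)
next
  assume p: "p \<in> dual_real G \<and> (\<forall>i. r * of_int (\<alpha> $ i) \<le> Re (p (quot_vec G i)))"
  define q where "q = (\<lambda>X. of_real (1 / r) * p X)"
  have "q \<in> dual_real G"
    unfolding q_def using p dual_real_scale by blast
  moreover have "of_int (\<alpha> $ i) \<le> Re (q (quot_vec G i))" for i
    using p assms by (simp add: q_def field_simps Re_divide_of_real)
  ultimately have "q \<in> assoc_polyhedron G \<alpha>"
    by (simp add: assoc_polyhedron_def)
  moreover have "p = (\<lambda>X. of_real r * q X)"
    using assms by (simp add: q_def)
  ultimately show "p \<in> dilate r (assoc_polyhedron G \<alpha>)"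
    unfolding dilate_def by blast
qed

text \<open>For \<open>r = 0\<close> the dilate is only \<open>{0}\<close>; the recession directions \<open>p\<close> of \<open>\<Delta>\<close> enter the
  closure as limits of \<open>p + e q \<in> e \<cdot> \<Delta>\<close> for a fixed \<open>q \<in> \<Delta>\<close> and \<open>e \<rightarrow> 0\<close>.\<close>

lemma cone_over_eq:
  fixes G :: "(complex^'n) set" and \<alpha> :: "int^'n"
  assumes "assoc_polyhedron G \<alpha> \<noteq> {}"
  shows "cone_over G \<alpha> =
    {(p, r). p \<in> dual_real G \<and> 0 \<le> r \<and> (\<forall>i. r * of_int (\<alpha> $ i) \<le> Re (p (quot_vec G i)))}"
    (is "_ = ?C")
proof -
  define S where "S = {(p, r). r \<ge> 0 \<and> p \<in> dilate r (assoc_polyhedron G \<alpha>)}"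
  \<comment> \<open>Membership in \<open>dual_real G\<close> is left out: the relative closure
    supplies it, so only weak inequalities between continuous functions have to define a closed
    set.\<close>
  define K where "K = {x :: ((complex^'n) set \<Rightarrow> complex) \<times> real.
    0 \<le> snd x \<and> (\<forall>i. snd x * of_int (\<alpha> $ i) \<le> Re (fst x (quot_vec G i)))}"
  have S_real: "S \<subseteq> dual_real G \<times> UNIV"
    by (auto simp: S_def dilate_def assoc_polyhedron_def dual_real_scale)
  have cone: "cone_over G \<alpha> = (dual_real G \<times> UNIV) \<inter> closure S"
    unfolding cone_over_def S_def[symmetric] using S_real
    by (simp add: closure_of_subtopology inf.absorb2)
  have "continuous_on UNIV (\<lambda>x :: ((complex^'n) set \<Rightarrow> complex) \<times> real. fst x X)" for X
    by (rule continuous_on_product_then_coordinatewise) (intro continuous_intros)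
  then have "closed K"
    unfolding K_def by (intro closed_Collect_conj closed_Collect_all closed_Collect_le continuous_intros) auto
  moreover have "S \<subseteq> K"
    by (auto simp: S_def K_def dilate_def assoc_polyhedron_def mult_left_mono)
  ultimately have "closure S \<subseteq> K"
    by (rule closure_minimal[rotated])
  then have "cone_over G \<alpha> \<subseteq> ?C"
    by (auto simp: cone K_def)
  moreover have "(p, r) \<in> closure S"
    if p: "p \<in> dual_real G" "0 \<le> r" "\<And>i. r * of_int (\<alpha> $ i) \<le> Re (p (quot_vec G i))" for p r
  proof -
    obtain q where q: "q \<in> dual_real G" "\<And>i. of_int (\<alpha> $ i) \<le> Re (q (quot_vec G i))"
      using assms by (auto simp: assoc_polyhedron_def)
    define g where "g e = ((\<lambda>X. p X + of_real e * q X), r + e)" for e :: real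
    \<comment> \<open>Since \<open>r + e\<close> is positive even when \<open>r = 0\<close>,
      \<open>dilate_polyhedron\<close> applies along the curve.\<close>
    have "g ` {0<..} \<subseteq> S"
    proof (rule image_subsetI)
      fix e :: real assume "e \<in> {0<..}"
      then have e: "e > 0"
        by simp
      have "(r + e) * of_int (\<alpha> $ i) \<le> Re (p (quot_vec G i) + of_real e * q (quot_vec G i))" for i
      proof -
        have "e * of_int (\<alpha> $ i) \<le> e * Re (q (quot_vec G i))"
          by (rule mult_left_mono) (use q(2) e in auto)
        from add_mono[OF p(3) this] show ?thesis
          by (simp add: distrib_right)
      qed
      then show "g e \<in> S"
        using e p(1,2) q(1) by (simp add: g_def S_def dilate_polyhedron dual_real_add dual_real_scale)
    qed
    \<comment> \<open>Continuity up to the endpoint 0 carries \<open>g 0\<close> into the closure of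
      \<open>S\<close>.\<close>
    moreover have "continuous_on (closure {0<..}) g"
      unfolding g_def
      by (intro continuous_on_Pair continuous_on_coordinatewise_then_product continuous_intros)
    ultimately have "g ` closure {0<..} \<subseteq> closure S"
      by (intro image_closure_subset) (auto intro: closure_subset[THEN subsetD])
    moreover have "g 0 = (p, r)"
      by (simp add: g_def)
    ultimately show ?thesis
      by (force simp: closure_greaterThan)
  qed
  ultimately show ?thesis
    by (auto simp: cone)
qed


section \<open>Invariant monomials\<close>

text \<open>The character through which the torus acts on the monomial \<open>m\<close>; each factor
  of the variable \<open>None\<close> contributes \<alpha>.\<close>

definition weight :: "int^'n \<Rightarrow> ('n option \<Rightarrow>\<^sub>0 nat) \<Rightarrow> int^'n" where
  "weight \<alpha> m = (\<chi> i. int (Poly_Mapping.lookup m (Some i)) + int (Poly_Mapping.lookup m None) * \<alpha> $ i)"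

lemma weight_add: "weight \<alpha> (m + m') = weight \<alpha> m + weight \<alpha> m'"
  by (simp add: weight_def vec_eq_iff lookup_add algebra_simps)

lemma weight_zero: "weight \<alpha> 0 = 0"
  by (simp add: weight_def vec_eq_iff)

section \<open>The torus action on monomials\<close>

lemma pconst_power: "pconst c ^ k = pconst (c ^ k)"
  by (induction k) (simp_all add: pconst_def mult_single)

lemma pvar_power: "pvar v ^ k = Poly_Mapping.single (Poly_Mapping.single v k) 1"
  by (induction k) (simp_all add: pvar_def mult_single flip: single_add)

lemma prod_pconst_pvar:
  assumes "finite A"
  shows "(\<Prod>v\<in>A. (pconst (c v) * pvar v) ^ k v) =
    Poly_Mapping.single (\<Sum>v\<in>A. Poly_Mapping.single v (k v)) (\<Prod>v\<in>A. c v ^ k v)"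
  using assms
  by (induction A)
    (simp_all add: power_mult_distrib pconst_power pvar_power, simp_all add: pconst_def mult_single)

lemma sum_single_lookup:
  fixes m :: "'a::finite \<Rightarrow>\<^sub>0 nat"
  shows "(\<Sum>v\<in>UNIV. Poly_Mapping.single v (Poly_Mapping.lookup m v)) = m"
  by (rule poly_mapping_eqI) (simp add: lookup_sum lookup_single when_def)

lemma prod_option:
  "(\<Prod>v\<in>(UNIV :: 'n::finite option set). h v) = h None * (\<Prod>i\<in>UNIV. h (Some i))"
  by (simp add: UNIV_option_conv prod.reindex)

text \<open>Rescaling the variables makes every monomial an eigenvector, so the action is diagonal
  on coefficients.\<close>

lemma lookup_torus_act:
  assumes "l \<in> carrier torus"
  shows "Poly_Mapping.lookup (torus_act \<alpha> l f) m = character (weight \<alpha> m) l * Poly_Mapping.lookup f m"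
proof -
  define c where "c v = (case v of Some i \<Rightarrow> l $ i | None \<Rightarrow> \<Prod>i\<in>UNIV. (l $ i) powi (\<alpha> $ i))" for v
  \<comment> \<open>The exponent law for integer powers is applied through this nonvanishing, as
    \<alpha> may have negative entries.\<close>
  have nz: "l $ i \<noteq> 0" for i
    using assms by (simp add: torus_def)
  have c: "(\<Prod>v\<in>UNIV. c v ^ Poly_Mapping.lookup m v) = character (weight \<alpha> m) l" for m
    by (simp add: prod_option c_def character_def weight_def power_int_add[OF disjI1[OF nz]]
        prod.distrib prod_power_distrib power_int_mult mult.commute[of "int _" "\<alpha> $ _"])
  have "torus_act \<alpha> l f =
      psubst (\<lambda>v. pconst (c v) * pvar v) f"
    unfolding torus_act_def by (rule arg_cong[of _ _ "\<lambda>s. psubst s f"])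
      (auto simp: fun_eq_iff c_def split: option.splits)
  also have "\<dots> = (\<Sum>m\<in>Poly_Mapping.keys f.
      Poly_Mapping.single m (Poly_Mapping.lookup f m * character (weight \<alpha> m) l))"
    by (simp add: psubst_def prod_pconst_pvar sum_single_lookup c)
      (simp add: pconst_def mult_single)
  finally show ?thesis
    by (simp add: lookup_sum lookup_single when_def in_keys_iff mult.commute)
qed

section \<open>Invariant monomials and lattice points of the cone\<close>

definition invariant_monomials :: "(complex^'n) set \<Rightarrow> int^'n \<Rightarrow> ('n option \<Rightarrow>\<^sub>0 nat) set" where
  "invariant_monomials G \<alpha> = {m. weight \<alpha> m \<in> trivial_characters G}"

text \<open>Comparing coefficients, a nonzero coefficient is fixed by \<open>l\<close> exactly when
  its eigenvalue is 1.\<close>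

lemma invariants_eq:
  assumes "subgroup G torus"
  shows "invariants G \<alpha> = {f. Poly_Mapping.keys f \<subseteq> invariant_monomials G \<alpha>}"
proof -
  have "torus_act \<alpha> l f = f \<longleftrightarrow> (\<forall>m\<in>Poly_Mapping.keys f. character (weight \<alpha> m) l = 1)"
    if "l \<in> G" for l f
  proof -
    have "l \<in> carrier torus"
      using that subgroup.subset[OF assms] by blast
    then show ?thesis
      by (auto simp: poly_mapping_eq_iff fun_eq_iff lookup_torus_act in_keys_iff)
  qed
  then show ?thesis
    by (auto simp: invariants_def invariant_monomials_def trivial_characters_def)
qed

text \<open>Total on all monomials, as \<open>push_keys_mult\<close> demands, though meaningful on
  the invariant ones.\<close>

definition cone_point ::
  "(complex^'n) set \<Rightarrow> int^'n \<Rightarrow> ('n option \<Rightarrow>\<^sub>0 nat) \<Rightarrow> ((complex^'n) set \<Rightarrow> complex) \<times> int" where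
  "cone_point G \<alpha> m = (char_functional G (weight \<alpha> m), int (Poly_Mapping.lookup m None))"

lemma cone_point_add: "cone_point G \<alpha> (m + m') = cone_point G \<alpha> m + cone_point G \<alpha> m'"
  by (simp add: cone_point_def weight_add char_functional_add lookup_add)

lemma cone_point_zero: "cone_point G \<alpha> 0 = 0"
  by (simp add: cone_point_def weight_zero char_functional_zero zero_prod_def)

text \<open>The second component gives the degree in \<open>None\<close>, and evaluation on
  \<open>quot_vec\<close> gives the weight; subtracting the share of \<alpha> leaves the other
  exponents.\<close>

lemma inj_on_cone_point:
  assumes "subgroup G torus"
  shows "inj_on (cone_point G \<alpha>) (invariant_monomials G \<alpha>)"
proof (rule inj_onI)
  fix m m'
  assume m: "m \<in> invariant_monomials G \<alpha>" "m' \<in> invariant_monomials G \<alpha>"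
    and eq: "cone_point G \<alpha> m = cone_point G \<alpha> m'"
  have N: "Poly_Mapping.lookup m None = Poly_Mapping.lookup m' None"
    using eq by (simp add: cone_point_def)
  have "(of_int (weight \<alpha> m $ i) :: complex) = of_int (weight \<alpha> m' $ i)" for i
    using eq m char_functional_vec[OF assms, of "weight \<alpha> m" i] char_functional_vec[OF assms, of "weight \<alpha> m'" i]
    by (simp add: cone_point_def invariant_monomials_def)
  then have "Poly_Mapping.lookup m (Some i) = Poly_Mapping.lookup m' (Some i)" for i
    using N by (simp add: weight_def)
  then have "Poly_Mapping.lookup m v = Poly_Mapping.lookup m' v" for v
    using N by (cases v) auto
  then show "m = m'"
    by (rule poly_mapping_eqI)
qed

text \<open>The cone inequalities say precisely that the exponents
  \<open>w $ i - k * \<alpha> $ i\<close> and \<open>k\<close> are nonnegative, hence exponents of a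
  monomial.\<close>

lemma cone_point_image:
  assumes "subgroup G torus" "assoc_polyhedron G \<alpha> \<noteq> {}"
  shows "cone_point G \<alpha> ` invariant_monomials G \<alpha> = cone_semigroup G \<alpha>"
proof (intro equalityI image_subsetI subrelI)
  fix m assume m: "m \<in> invariant_monomials G \<alpha>"
  then have w: "weight \<alpha> m \<in> trivial_characters G"
    by (simp add: invariant_monomials_def)
  note L = char_functional_in_dual_lattice[OF assms(1) w]
  have "real (Poly_Mapping.lookup m None) * of_int (\<alpha> $ i) \<le> of_int (weight \<alpha> m $ i)" for i
    by (simp add: weight_def)
  then show "cone_point G \<alpha> m \<in> cone_semigroup G \<alpha>"
    using L dual_lattice_in_real[OF L]
    by (simp add: cone_point_def cone_semigroup_def cone_over_eq[OF assms(2)]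
        char_functional_vec[OF assms(1) w])
next
  fix p k assume "(p, k) \<in> cone_semigroup G \<alpha>"
  then have p: "p \<in> dual_lattice G" "0 \<le> k"
    "\<And>i. of_int k * of_int (\<alpha> $ i) \<le> Re (p (quot_vec G i))"
    by (auto simp: cone_semigroup_def cone_over_eq[OF assms(2)])
  obtain w where w: "w \<in> trivial_characters G" "p = char_functional G w"
    using dual_lattice_eq_char_functional[OF assms(1) p(1)] .
  have "real_of_int (k * \<alpha> $ i) \<le> real_of_int (w $ i)" for i
    using p(3)[of i] by (simp add: w(2) char_functional_vec[OF assms(1) w(1)])
  then have le: "k * \<alpha> $ i \<le> w $ i" for i
    by (simp only: of_int_le_iff)
  \<comment> \<open>The two uses of \<open>nat\<close> do not truncate, by \<open>le\<close> and
    \<open>0 \<le> k\<close>; the support is finite because the variables are.\<close>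
  define m where "m = Abs_poly_mapping
    (\<lambda>v. case v of None \<Rightarrow> nat k | Some i \<Rightarrow> nat (w $ i - k * \<alpha> $ i))"
  have "Poly_Mapping.lookup m =
      (\<lambda>v. case v of None \<Rightarrow> nat k | Some i \<Rightarrow> nat (w $ i - k * \<alpha> $ i))"
    unfolding m_def by (rule Abs_poly_mapping_inverse) simp
  then have "weight \<alpha> m = w" "int (Poly_Mapping.lookup m None) = k"
    using le p(2) by (simp_all add: weight_def vec_eq_iff)
  then show "(p, k) \<in> cone_point G \<alpha> ` invariant_monomials G \<alpha>"
    using w by (intro image_eqI[of _ _ m]) (simp_all add: cone_point_def invariant_monomials_def)
qed

text \<open>If \<Delta> were empty, all its dilates would be empty, even for \<open>r = 0\<close>;
  the semigroup ring would then be zero, while the invariants always contain the constants.\<close>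

theorem theorem2p2:
  fixes \<alpha> :: "int^'n" and G :: "(complex^'n) set"
  assumes "algebraic_subgroup G"
    and "assoc_polyhedron G \<alpha> \<noteq> {}"
  shows "graded_ring_iso
      (invariant_ring G \<alpha>) (invariant_ring_part G \<alpha>)
      (semigroup_ring (cone_semigroup G \<alpha>)) (semigroup_ring_part (cone_semigroup G \<alpha>))"
proof -
  have G: "subgroup G torus"
    using assms(1) by (simp add: algebraic_subgroup_def)
  let ?M = "invariant_monomials G \<alpha>" and ?S = "cone_semigroup G \<alpha>" and ?\<phi> = "cone_point G \<alpha>"
  have inj: "inj_on ?\<phi> ?M"
    by (rule inj_on_cone_point[OF G])
  have image: "?\<phi> ` ?M = ?S"
    by (rule cone_point_image[OF G assms(2)])
  have "push_keys ?\<phi> (1 :: 'n pol) = 1"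
    using push_keys_single[of ?\<phi> 0 "1 :: complex"] by (simp add: cone_point_zero)
  then have "push_keys ?\<phi> \<in> ring_iso (invariant_ring G \<alpha>) (semigroup_ring ?S)"
    using bij_betw_push_keys[OF inj] image
    by (auto simp: ring_iso_def ring_hom_def invariant_ring_def semigroup_ring_def ring_on_def
        invariants_eq[OF G] push_keys_add push_keys_mult[OF cone_point_add] bij_betw_def)
  moreover have "push_keys ?\<phi> ` invariant_ring_part G \<alpha> d = semigroup_ring_part ?S d" for d
  proof -
    \<comment> \<open>\<open>cone_point\<close> preserves degree, so the bijection for supports is
      applied again, now to the monomials of degree \<open>d\<close>.\<close>
    let ?Md = "{m \<in> ?M. int (Poly_Mapping.lookup m None) = d}"
    have "?\<phi> ` ?Md = {(p, k) \<in> ?S. k = d}"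
      unfolding image[symmetric] by (auto simp: cone_point_def)
    moreover have "invariant_ring_part G \<alpha> d = {f. Poly_Mapping.keys f \<subseteq> ?Md}"
      by (auto simp: invariant_ring_part_def invariants_eq[OF G])
    moreover have "inj_on ?\<phi> ?Md"
      using inj by (rule inj_on_subset) auto
    ultimately show ?thesis
      using bij_betw_push_keys[of ?\<phi> ?Md, where 'c = complex] by (simp add: bij_betw_def semigroup_ring_part_def)
  qed
  ultimately show ?thesis
    unfolding graded_ring_iso_def by blast
qed

end
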